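(* For every even integer $d \geq 6$ and every integer $k$ with $2 \leq k \leq (d-2)/2$, there exist centrally symmetric $k$-neighborly Bier $(d-2)$-spheres on $2d$ vertices that are not cs-polytopal.
   Context: A simplicial complex $\Delta$ on a finite set $V$ is a collection of subsets (faces) of $V$ closed under inclusion; singletons of $V$ are not required to be faces. The vertices of $\Delta$ are the elements $v$ with $\{v\}\in\Delta$. Its Alexander dual is $\Delta^* = \{V\setminus\sigma : \sigma\subseteq V,\ \sigma\notin\Delta\}$. Bier spheres: for a simplicial complex $\Delta$ on $[n]=\{1,\dots,n\}$, take $2n$ distinct elements $x_1,\dots,x_n,y_1,\dots,y_n$. Then $$\mathrm{Bier}(\Delta)=\{\{x_i: i\in\sigma\}\cup\{y_j: j\in\tau\} : \sigma\in\Delta,\ \tau\in\Delta^*,\ \sigma\cap\tau=\emptyset\},$$ which is a simplicial $(n-2)$-sphere, called the Bier sphere of $\Delta$. A simplicial complex is centrally symmetric (cs) if there is an involution $\iota$ on its vertices that maps faces to faces and satisfies $\iota(\sigma)\neq\sigma$ for every nonempty face $\sigma$; $v$ and $\iota(v)$ are called antipodal. A cs simplicial complex is (cs) $k$-neighborly if every set of $k$ of its vertices containing no antipodal pair is a face. A polytope $P\subset\mathbb{R}^m$ is centrally symmetric (cs) if $P=-P$. A cs simplicial sphere is cs-polytopal if it is combinatorially isomorphic to the boundary complex of a cs simplicial polytope. *)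

theory Defs
  imports "HOL-Analysis.Analysis" "HOL-Analysis.Finite_Function_Topology"
begin

section \<open>Abstract simplicial complexes\<close>

text \<open>The library predicate \<open>simplicial_complex\<close> is about geometric complexes; the following is
  the abstract notion. Singletons of \<open>V\<close> need not be faces, so \<open>vertices\<close> may be smaller
  than \<open>V\<close>.\<close>

definition abs_complex_on :: "'a set \<Rightarrow> 'a set set \<Rightarrow> bool" where
  "abs_complex_on V \<Delta> \<longleftrightarrow>
     finite V \<and> \<Delta> \<subseteq> Pow V \<and> (\<forall>\<sigma>\<in>\<Delta>. \<forall>\<tau>. \<tau> \<subseteq> \<sigma> \<longrightarrow> \<tau> \<in> \<Delta>)"

definition vertices :: "'a set set \<Rightarrow> 'a set" where
  "vertices \<Delta> = {v. {v} \<in> \<Delta>}"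

definition alexander_dual :: "'a set \<Rightarrow> 'a set set \<Rightarrow> 'a set set" where
  "alexander_dual V \<Delta> = {V - \<sigma> | \<sigma>. \<sigma> \<subseteq> V \<and> \<sigma> \<notin> \<Delta>}"

definition complex_iso :: "'a set set \<Rightarrow> 'b set set \<Rightarrow> bool" where
  "complex_iso K L \<longleftrightarrow>
     (\<exists>f. bij_betw f (vertices K) (vertices L) \<and> (\<lambda>\<sigma>. f ` \<sigma>) ` K = L)"


section \<open>Bier spheres\<close>

text \<open>\<open>x\<^sub>i\<close> is \<open>Inl i\<close> and \<open>y\<^sub>j\<close> is \<open>Inr j\<close>.\<close>

definition bier :: "'a set \<Rightarrow> 'a set set \<Rightarrow> ('a + 'a) set set" where
  "bier V \<Delta> =
     {Inl ` \<sigma> \<union> Inr ` \<tau> | \<sigma> \<tau>. \<sigma> \<in> \<Delta> \<and> \<tau> \<in> alexander_dual V \<Delta> \<and> \<sigma> \<inter> \<tau> = {}}"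

text \<open>The Bier sphere of a complex on \<open>{1..n}\<close> has dimension \<open>n - 2\<close>, so a Bier \<open>m\<close>-sphere comes
  from a complex on \<open>{1..m + 2}\<close>. For \<open>\<Delta> = {}\<close> and for the full simplex, \<open>bier\<close> is empty and not
  a sphere, so these two are excluded.\<close>

definition bier_sphere :: "nat \<Rightarrow> (nat + nat) set set \<Rightarrow> bool" where
  "bier_sphere m K \<longleftrightarrow>
     (\<exists>\<Delta>. abs_complex_on {1..m + 2} \<Delta> \<and> \<Delta> \<noteq> {} \<and> \<Delta> \<noteq> Pow {1..m + 2} \<and> K = bier {1..m + 2} \<Delta>)"


section \<open>Central symmetry and neighborliness\<close>

definition cs_involution :: "('a \<Rightarrow> 'a) \<Rightarrow> 'a set set \<Rightarrow> bool" where
  "cs_involution \<iota> K \<longleftrightarrow>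
     (\<forall>v\<in>vertices K. \<iota> v \<in> vertices K \<and> \<iota> (\<iota> v) = v) \<and>
     (\<forall>\<sigma>\<in>K. \<iota> ` \<sigma> \<in> K) \<and>
     (\<forall>\<sigma>\<in>K. \<sigma> \<noteq> {} \<longrightarrow> \<iota> ` \<sigma> \<noteq> \<sigma>)"

definition cs_neighborly :: "nat \<Rightarrow> 'a set set \<Rightarrow> bool" where
  "cs_neighborly k K \<longleftrightarrow>
     (\<exists>\<iota>. cs_involution \<iota> K \<and>
       (\<forall>S. S \<subseteq> vertices K \<and> finite S \<and> card S = k \<and> (\<forall>v\<in>S. \<iota> v \<notin> S) \<longrightarrow> S \<in> K))"


section \<open>Centrally symmetric polytopes\<close>

text \<open>\<open>coord_space m\<close> is \<open>\<real>\<^sup>m\<close>, realised as the vectors supported on the first \<open>m\<close> coordinates in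
  the space of finitely supported real sequences, so that one can quantify over \<open>m\<close> inside a
  formula.\<close>

definition coord_space :: "nat \<Rightarrow> (nat \<Rightarrow>\<^sub>0 real) set" where
  "coord_space m = {x. Poly_Mapping.keys x \<subseteq> {..<m}}"

text \<open>The library predicate \<open>simplex\<close> is confined to \<open>euclidean_space\<close> types; the matrix below is its
  definition, with \<open>C\<close> the vertex set of the simplex. The empty face is the convex hull of \<open>{}\<close>.\<close>

definition simplicial_polytope :: "'a::real_vector set \<Rightarrow> bool" where
  "simplicial_polytope P \<longleftrightarrow>
     polytope P \<and>
     (\<forall>F. F face_of P \<and> F \<noteq> P \<longrightarrow> (\<exists>C. finite C \<and> \<not> affine_dependent C \<and> F = convex hull C))"

definition boundary_complex :: "'a::real_vector set \<Rightarrow> 'a set set" where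
  "boundary_complex P = {{v. v extreme_point_of F} | F. F face_of P \<and> F \<noteq> P}"

definition cs_polytopal :: "'a set set \<Rightarrow> bool" where
  "cs_polytopal K \<longleftrightarrow>
     (\<exists>m P. P \<subseteq> coord_space m \<and> simplicial_polytope P \<and> uminus ` P = P \<and>
            complex_iso K (boundary_complex P))"

end

theory Submission
  imports Defs
begin

text \<open>If \<open>\<Delta>\<close> is its own Alexander dual and contains all pairs, then in any cs realisation of \<open>bier V \<Delta>\<close>
  the vertex \<open>y\<^sub>i\<close> is placed at \<open>- p\<^sub>i\<close>, where \<open>p\<^sub>i\<close> is the place of \<open>x\<^sub>i\<close>. The \<open>p\<^sub>i\<close> are linearly
  dependent, for otherwise the polytope would be a cross-polytope and all the \<open>x\<^sub>i\<close> together would form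
  a face. The coefficients \<open>a\<^sub>i\<close> of a linear relation then make \<open>\<Delta>\<close> a threshold complex: adding \<open>j\<close>
  to a facet \<open>\<sigma>\<close> of \<open>\<Delta>\<close> changes the sign of \<open>a(\<sigma>) - a(V - \<sigma>)\<close>. With \<open>|V| = 2h\<close>, let \<open>\<Delta>\<close> consist of
  all sets with fewer than \<open>h\<close> elements and one set of each complementary pair of \<open>h\<close>-sets. This is
  self-dual and its Bier sphere is \<open>(h - 1)\<close>-neighborly, but it is not threshold as soon as it contains
  four \<open>h\<close>-sets that together cover each element of \<open>V\<close> exactly twice.\<close>

section \<open>Extreme points, faces and central symmetry\<close>

text \<open>Generators lying in the hull of the others can be discarded one by one; when none is
  left to discard, every generator is extreme. The argument is purely algebraic, so it applies to
  \<open>nat \<Rightarrow>\<^sub>0 real\<close>.\<close>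

lemma convex_hull_extreme_points:
  fixes S :: "'a::real_vector set"
  assumes "finite S"
  shows "convex hull S = convex hull {x. x extreme_point_of convex hull S}"
  using assms
proof (induction "card S" arbitrary: S rule: less_induct)
  case less
  show ?case
  proof (cases "\<exists>x\<in>S. x \<in> convex hull (S - {x})")
    case True
    then obtain x where x: "x \<in> S" "x \<in> convex hull (S - {x})" by blast
    then have "convex hull (S - {x}) = convex hull S"
      by (metis hull_redundant insert_Diff)
    with less.hyps [of "S - {x}"] less.prems x show ?thesis
      by (metis card_Diff1_less finite_Diff)
  next
    case False
    then have "x extreme_point_of convex hull S" if "x \<in> S" for x
      using extreme_point_of_convex_hull_insert [of "S - {x}" x] that less.prems
      by (simp add: insert_absorb)
    then have "{x. x extreme_point_of convex hull S} = S"
      using extreme_point_of_convex_hull by blast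
    then show ?thesis by simp
  qed
qed

text \<open>The cases \<open>t = 1\<close> and \<open>p = q\<close>, in which the combination does
  not lie in the open segment, are included so that extreme weights need no separate treatment
  later.\<close>

lemma face_of_convex_combination:
  assumes "F face_of P" "p \<in> P" "q \<in> P" "0 < t" "t \<le> 1" "t *\<^sub>R p + (1 - t) *\<^sub>R q \<in> F"
  shows "p \<in> F"
proof (cases "t = 1 \<or> p = q")
  case True
  then show ?thesis using assms by (auto simp flip: scaleR_left_distrib)
next
  case False
  then have "t *\<^sub>R p + (1 - t) *\<^sub>R q \<in> open_segment q p"
    using assms by (auto simp: in_segment add.commute)
  then show ?thesis using face_ofD assms by blast
qed

text \<open>The missing weight \<open>1 - sum \<mu> I\<close> is given to the origin.\<close>

lemma convex_sum_le_1:
  fixes w :: "'i \<Rightarrow> 'a::real_vector"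
  assumes "convex P" "0 \<in> P" "finite I"
    and "\<And>i. i \<in> I \<Longrightarrow> 0 \<le> \<mu> i" "\<And>i. i \<in> I \<Longrightarrow> w i \<in> P" "sum \<mu> I \<le> 1"
  shows "(\<Sum>i\<in>I. \<mu> i *\<^sub>R w i) \<in> P"
proof (cases "sum \<mu> I = 0")
  case True
  then have "\<mu> i = 0" if "i \<in> I" for i using assms that by (simp add: sum_nonneg_eq_0_iff)
  then show ?thesis using assms by simp
next
  case False
  define s where "s = sum \<mu> I"
  have s: "s > 0" "s \<le> 1" using False assms by (auto simp: s_def sum_nonneg order_less_le)
  have "(\<Sum>i\<in>I. (\<mu> i / s) *\<^sub>R w i) \<in> P"
    using s assms by (intro convex_sum) (auto simp flip: sum_divide_distrib simp: s_def)
  then have "(1 - s) *\<^sub>R 0 + s *\<^sub>R (\<Sum>i\<in>I. (\<mu> i / s) *\<^sub>R w i) \<in> P"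
    using assms s unfolding convex_alt by force
  then show ?thesis using s by (simp add: scaleR_sum_right)
qed

text \<open>The origin is the midpoint of \<open>x\<close> and \<open>- x\<close> for every
  \<open>x\<close> in \<open>P\<close>, so a face containing it would contain all of
  \<open>P\<close>.\<close>

lemma zero_notin_proper_face:
  fixes P :: "'a::real_vector set"
  assumes "F face_of P" "F \<noteq> P" "uminus ` P = P"
  shows "0 \<notin> F"
proof
  assume 0: "0 \<in> F"
  have "x \<in> F" if "x \<in> P" for x
  proof -
    have "- x \<in> P" using that assms(3) by blast
    moreover have "(1/2) *\<^sub>R x + (1 - 1/2) *\<^sub>R (- x) \<in> F" using 0 by simp
    ultimately show ?thesis using face_of_convex_combination [OF assms(1) that, of "- x" "1/2"] by simp
  qed
  then show False using assms face_of_imp_subset by blast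
qed

section \<open>Linear relations between points of a proper face and a point off it\<close>

lemma proper_face_relation_nonneg:
  fixes P :: "'a::real_vector set"
  assumes F: "F face_of P" "0 \<notin> F" and P: "convex P" "0 \<in> P" and u: "- u \<in> P" "- u \<notin> F"
    and I: "finite I" "\<And>i. i \<in> I \<Longrightarrow> w i \<in> F"
    and w: "inj_on w I" "\<not> affine_dependent (w ` I)"
    and rel: "(\<Sum>i\<in>I. b i *\<^sub>R w i) + c *\<^sub>R u = 0" "c \<noteq> 0 \<or> (\<exists>i\<in>I. b i \<noteq> 0)"
    and c: "0 \<le> c"
  shows "sum b I < c"
  \<comment> \<open>Otherwise, separating the positive and negative \<open>b i\<close> in the relation writes a point of \<open>F\<close> as a
    convex combination of points of \<open>P\<close> in which \<open>- u\<close> or \<open>0\<close> has positive weight, unless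
    \<open>c = sum b I = 0\<close>, which is an affine dependence.\<close>
proof (rule ccontr)
  assume "\<not> sum b I < c"
  define T N where "T = (\<Sum>i\<in>I. max (b i) 0)" and "N = (\<Sum>i\<in>I. max (- b i) 0)"
  have nonneg: "T \<ge> 0" "N \<ge> 0" unfolding T_def N_def by (auto intro: sum_nonneg)
  have b: "b i = max (b i) 0 - max (- b i) 0" for i by auto
  have TN: "T - N \<ge> c"
    using \<open>\<not> sum b I < c\<close> unfolding T_def N_def sum_subtractf [symmetric] b [symmetric] by simp
  have wP: "w i \<in> P" if "i \<in> I" for i using that I F face_of_imp_subset by blast
  have T: "T > 0"
  proof (rule ccontr)
    assume "\<not> T > 0"
    then have "T = 0" "N = 0" "c = 0" using nonneg TN c by auto
    then have "max (b i) 0 = 0 \<and> max (- b i) 0 = 0" if "i \<in> I" for i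
      using that I(1) unfolding T_def N_def by (subst (asm) (1 2) sum_nonneg_eq_0_iff) auto
    then have "b i = 0" if "i \<in> I" for i using that b by force
    then show False using rel(2) \<open>c = 0\<close> by blast
  qed
  have rel': "(\<Sum>i\<in>I. max (b i) 0 *\<^sub>R w i) = (\<Sum>i\<in>I. max (- b i) 0 *\<^sub>R w i) + c *\<^sub>R (- u)"
  proof -
    have "(\<Sum>i\<in>I. b i *\<^sub>R w i) = (\<Sum>i\<in>I. max (b i) 0 *\<^sub>R w i) - (\<Sum>i\<in>I. max (- b i) 0 *\<^sub>R w i)"
      by (simp only: sum_subtractf [symmetric] scaleR_left_diff_distrib [symmetric] b [symmetric])
    moreover have "c *\<^sub>R u = - (\<Sum>i\<in>I. b i *\<^sub>R w i)"
      using rel(1) by (simp add: eq_neg_iff_add_eq_0 add.commute)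
    ultimately show ?thesis by simp
  qed
  define x where "x = (\<Sum>i\<in>I. (max (b i) 0 / T) *\<^sub>R w i)"
  have xF: "x \<in> F"
    unfolding x_def using T I F
    by (intro convex_sum) (auto simp: face_of_imp_convex T_def simp flip: sum_divide_distrib)
  have x: "x = (1 / T) *\<^sub>R (\<Sum>i\<in>I. max (- b i) 0 *\<^sub>R w i) + (c / T) *\<^sub>R (- u)"
    using arg_cong [OF rel', of "\<lambda>y. (1 / T) *\<^sub>R y"]
    unfolding x_def by (simp add: scaleR_sum_right algebra_simps)
  show False
  proof (cases "c = 0")
    case False
    \<comment> \<open>Since \<open>N \<le> T - c\<close>, the weights sum to at most 1. If
      \<open>T = c\<close>, division by zero gives \<open>z = 0\<close>, which is harmless because
      its coefficient \<open>1 - c / T\<close> below vanishes.\<close>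
    define z where "z = (\<Sum>i\<in>I. (max (- b i) 0 / (T - c)) *\<^sub>R w i)"
    have "z \<in> P"
      unfolding z_def using P I wP TN nonneg
      by (intro convex_sum_le_1) (auto simp flip: sum_divide_distrib N_def simp: divide_le_eq_1)
    have cT: "0 < c / T" "c / T \<le> 1" using False c T TN nonneg by auto
    have "x = (c / T) *\<^sub>R (- u) + (1 - c / T) *\<^sub>R z"
    proof (cases "T = c")
      case True
      then have "N = 0" using TN nonneg by simp
      then have "max (- b i) 0 = 0" if "i \<in> I" for i
        using that I(1) unfolding N_def by (subst (asm) sum_nonneg_eq_0_iff) auto
      then show ?thesis using True T by (simp add: x)
    next
      case False
      have "(1 - c / T) *\<^sub>R z = (1 / T) *\<^sub>R (\<Sum>i\<in>I. max (- b i) 0 *\<^sub>R w i)"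
        unfolding z_def scaleR_sum_right
        by (intro sum.cong refl) (use False T in \<open>simp add: field_simps\<close>)
      then show ?thesis by (simp add: x)
    qed
    then have "- u \<in> F"
      using face_of_convex_combination [OF F(1) u(1) \<open>z \<in> P\<close> cT] xF by simp
    then show False using u by simp
  next
    case c0: True
    show False
    proof (cases "N < T")
      case True
      \<comment> \<open>Again \<open>N = 0\<close> gives \<open>z = 0\<close>, still a point of
        \<open>P\<close>. The remaining weight \<open>1 - N / T\<close> falls on the origin.\<close>
      define z where "z = (\<Sum>i\<in>I. (max (- b i) 0 / N) *\<^sub>R w i)"
      have "z \<in> P"
        unfolding z_def using P I wP nonneg
        by (intro convex_sum_le_1) (auto simp flip: sum_divide_distrib N_def)
      have "(N / T) *\<^sub>R z = (1 / T) *\<^sub>R (\<Sum>i\<in>I. max (- b i) 0 *\<^sub>R w i)"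
      proof (cases "N = 0")
        case True
        then have "max (- b i) 0 = 0" if "i \<in> I" for i
          using that I(1) unfolding N_def by (subst (asm) sum_nonneg_eq_0_iff) auto
        then show ?thesis using True by simp
      next
        case False
        then show ?thesis
          unfolding z_def scaleR_sum_right by (intro sum.cong refl) simp
      qed
      then have "x = (1 - N / T) *\<^sub>R 0 + (1 - (1 - N / T)) *\<^sub>R z" using c0 x by simp
      then have "0 \<in> F"
        using face_of_convex_combination [OF F(1) P(2) \<open>z \<in> P\<close>, of "1 - N / T"] xF True T nonneg
        by simp
      then show False using F by simp
    next
      case False
      have "sum b I = 0"
      proof -
        have "sum b I = T - N"
          unfolding T_def N_def sum_subtractf [symmetric] b [symmetric] by simp
        then show ?thesis using False TN c0 by simp
      qed
      moreover have "(\<Sum>i\<in>I. b i *\<^sub>R w i) = 0" "\<exists>i\<in>I. b i \<noteq> 0" using rel c0 by auto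
      ultimately have "affine_dependent (w ` I)"
        using w(1) I(1)
        by (subst affine_dependent_explicit_finite)
           (auto intro!: exI [of _ "\<lambda>v. b (the_inv_into I w v)"] simp: sum.reindex the_inv_into_f_f
             cong: sum.cong)
      then show False using w by simp
    qed
  qed
qed

text \<open>By the symmetry of \<open>P\<close>, \<open>u\<close> may be replaced by
  \<open>- u\<close> and the relation negated so that the coefficient off the face is
  \<open>\<bar>c\<bar>\<close>. The one-sided bounds for \<open>b\<close> and for its negative then
  combine to the absolute value.\<close>

lemma proper_face_relation:
  fixes P :: "'a::real_vector set"
  assumes F: "F face_of P" "F \<noteq> P" and P: "convex P" "uminus ` P = P"
    and u: "u \<in> P" "u \<notin> F" "- u \<notin> F"
    and I: "finite I" "\<And>i. i \<in> I \<Longrightarrow> w i \<in> F"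
    and w: "inj_on w I" "\<not> affine_dependent (w ` I)"
    and rel: "(\<Sum>i\<in>I. b i *\<^sub>R w i) + c *\<^sub>R u = 0" "c \<noteq> 0 \<or> (\<exists>i\<in>I. b i \<noteq> 0)"
  shows "\<bar>sum b I\<bar> < \<bar>c\<bar>"
proof -
  have neg: "- x \<in> P" if "x \<in> P" for x using that P by blast
  have "(1/2) *\<^sub>R u + (1/2) *\<^sub>R (- u) \<in> P"
    using u(1) neg [OF u(1)] P(1) by (intro convexD) auto
  then have "0 \<in> P" by simp
  moreover have "0 \<notin> F" using zero_notin_proper_face F P by blast
  ultimately have *: "sum b' I < c'"
    if "(\<Sum>i\<in>I. b' i *\<^sub>R w i) + c' *\<^sub>R v = 0" "c' \<noteq> 0 \<or> (\<exists>i\<in>I. b' i \<noteq> 0)" "0 \<le> c'"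
      "v = u \<or> v = - u" for b' c' v
    using proper_face_relation_nonneg [OF F(1) _ P(1) _ _ _ I w that(1-3)] u neg that(4) by auto
  have rel': "(\<Sum>i\<in>I. - b i *\<^sub>R w i) + (- c) *\<^sub>R u = 0"
    using arg_cong [OF rel(1), of uminus] by (simp add: sum_negf)
  show ?thesis
  proof (cases "c \<ge> 0")
    case True
    have "sum b I < c" using * [of b c u] rel True by simp
    moreover have "(\<Sum>i\<in>I. - b i) < c"
      using * [of "\<lambda>i. - b i" c "- u"] rel rel' True by simp
    ultimately show ?thesis by (simp add: sum_negf)
  next
    case False
    have "sum b I < - c" using * [of b "- c" "- u"] rel False by simp
    moreover have "(\<Sum>i\<in>I. - b i) < - c"
      using * [of "\<lambda>i. - b i" "- c" u] rel rel' False by simp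
    ultimately show ?thesis by (simp add: sum_negf)
  qed
qed

section \<open>Faces and vertices of a Bier sphere\<close>

lemma mem_bier_iff:
  "S \<in> bier V \<Delta> \<longleftrightarrow>
     Inl -` S \<in> \<Delta> \<and> Inr -` S \<in> alexander_dual V \<Delta> \<and> Inl -` S \<inter> Inr -` S = {}"
proof
  assume "S \<in> bier V \<Delta>"
  then obtain \<sigma> \<tau> where "S = Inl ` \<sigma> \<union> Inr ` \<tau>" "\<sigma> \<in> \<Delta>" "\<tau> \<in> alexander_dual V \<Delta>" "\<sigma> \<inter> \<tau> = {}"
    unfolding bier_def by blast
  moreover from this have "Inl -` S = \<sigma>" "Inr -` S = \<tau>" by auto
  ultimately show "Inl -` S \<in> \<Delta> \<and> Inr -` S \<in> alexander_dual V \<Delta> \<and> Inl -` S \<inter> Inr -` S = {}"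
    by simp
next
  have "S = Inl ` (Inl -` S) \<union> Inr ` (Inr -` S)"
    by (auto simp: image_iff) (metis sumE)
  then show "S \<in> bier V \<Delta>"
    if "Inl -` S \<in> \<Delta> \<and> Inr -` S \<in> alexander_dual V \<Delta> \<and> Inl -` S \<inter> Inr -` S = {}"
    using that unfolding bier_def by blast
qed

lemma alexander_dual_subset: "alexander_dual V \<Delta> \<subseteq> Pow V"
  by (auto simp: alexander_dual_def)

lemma vimage_sum_singleton [simp]:
  "Inl -` {Inl i} = {i}" "Inr -` {Inr i} = {i}" "Inl -` {Inr i} = {}" "Inr -` {Inl i} = {}"
  by auto

lemma vertices_bier:
  assumes dual: "alexander_dual V \<Delta> = \<Delta>"
    and small: "\<And>\<sigma>. \<sigma> \<subseteq> V \<Longrightarrow> card \<sigma> \<le> 1 \<Longrightarrow> \<sigma> \<in> \<Delta>"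
  shows "vertices (bier V \<Delta>) = Inl ` V \<union> Inr ` V"
proof -
  have "{i} \<in> \<Delta> \<longleftrightarrow> i \<in> V" for i
    using small [of "{i}"] alexander_dual_subset [of V \<Delta>] dual by auto
  moreover have "{} \<in> \<Delta>" using small by simp
  ultimately have "v \<in> vertices (bier V \<Delta>) \<longleftrightarrow> v \<in> Inl ` V \<union> Inr ` V" for v
    by (cases v) (auto simp: vertices_def mem_bier_iff dual)
  then show ?thesis by blast
qed

section \<open>From a cs realisation to weights on the ground set\<close>

lemma polytope_eq_convex_hull_extreme_points:
  fixes P :: "'a::real_vector set"
  assumes "polytope P"
  shows "P = convex hull {x. x extreme_point_of P}"
  using assms convex_hull_extreme_points unfolding polytope_def by metis

lemma extreme_point_of_uminus:
  fixes P :: "'a::real_vector set"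
  assumes "x extreme_point_of P" "uminus ` P = P"
  shows "- x extreme_point_of P"
  using face_of_linear_image [of uminus "{x}" P] assms
  by (simp add: face_of_singleton module_hom_uminus)

text \<open>A proper average of two values that are at most \<open>c\<close> equals \<open>c\<close>
  only if both values do. This supplies the face in the cross-polytope argument.\<close>

lemma face_of_level_set:
  fixes g :: "'a::real_vector \<Rightarrow> real"
  assumes "linear g" "convex P" "\<And>x. x \<in> P \<Longrightarrow> g x \<le> c"
  shows "{x \<in> P. g x = c} face_of P"
  unfolding face_of_def
proof (intro conjI ballI impI)
  show "convex {x \<in> P. g x = c}"
    using assms(1,2) by (auto simp: convex_alt linear_add linear_diff linear_scale algebra_simps)
next
  fix a b x
  assume ab: "a \<in> P" "b \<in> P" and x: "x \<in> {x \<in> P. g x = c}" "x \<in> open_segment a b"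
  then obtain t where t: "0 < t" "t < 1" "x = (1 - t) *\<^sub>R a + t *\<^sub>R b"
    by (auto simp: in_segment)
  have "g x = (1 - t) * g a + t * g b"
    using assms(1) by (simp add: t(3) linear_add linear_scale)
  then have "(1 - t) * (c - g a) + t * (c - g b) = 0"
    using x(1) by (simp add: algebra_simps)
  moreover have "(1 - t) * (c - g a) \<ge> 0" "t * (c - g b) \<ge> 0"
    using t ab assms(3) by auto
  ultimately have "(1 - t) * (c - g a) = 0" "t * (c - g b) = 0" by linarith+
  then show "a \<in> {x \<in> P. g x = c}" "b \<in> {x \<in> P. g x = c}" using t ab by auto
qed auto

text \<open>The weights are the coefficients of a linear relation among the places of the x_i. The
  sets \<open>\<sigma>\<close> and \<open>V - \<sigma> - {j}\<close> form a face that misses only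
  the antipodal pair of \<open>j\<close>, and the bound is \<open>proper_face_relation\<close> for
  that face and the place of x_j.\<close>

lemma cs_polytopal_bier_weights:
  fixes V :: "'a set"
  assumes V: "finite V" and dual: "alexander_dual V \<Delta> = \<Delta>"
    and small: "\<And>\<sigma>. \<sigma> \<subseteq> V \<Longrightarrow> card \<sigma> \<le> 2 \<Longrightarrow> \<sigma> \<in> \<Delta>"
    and polytopal: "cs_polytopal (bier V \<Delta>)"
  obtains a :: "'a \<Rightarrow> real"
  where "\<And>\<sigma> j. \<lbrakk>\<sigma> \<in> \<Delta>; j \<in> V - \<sigma>; V - \<sigma> - {j} \<in> \<Delta>\<rbrakk> \<Longrightarrow>
           \<bar>sum a \<sigma> - sum a (V - \<sigma> - {j})\<bar> < \<bar>a j\<bar>"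
proof -
  define K where "K = bier V \<Delta>"
  have mem_K: "S \<in> K \<longleftrightarrow> Inl -` S \<in> \<Delta> \<and> Inr -` S \<in> \<Delta> \<and> Inl -` S \<inter> Inr -` S = {}" for S
    by (simp add: K_def mem_bier_iff dual)
  have \<Delta>: "\<Delta> \<subseteq> Pow V" using alexander_dual_subset [of V \<Delta>] dual by simp
  have "{} \<in> \<Delta>" using small by simp
  \<comment> \<open>By self-duality \<open>{}\<close> is the complement of a nonface, which can only
    be \<open>V\<close>.\<close>
  then have "V \<notin> \<Delta>" by (subst (asm) dual [symmetric]) (auto simp: alexander_dual_def)
  then have "V \<noteq> {}" using \<open>{} \<in> \<Delta>\<close> by auto
  have sing: "{i} \<in> \<Delta> \<longleftrightarrow> i \<in> V" for i using small [of "{i}"] \<Delta> by auto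
  have vertices_K: "vertices K = Inl ` V \<union> Inr ` V"
    unfolding K_def using dual small by (intro vertices_bier) auto
  have K_vertices: "S \<subseteq> vertices K" if "S \<in> K" for S
  proof
    fix v assume "v \<in> S"
    then show "v \<in> vertices K"
      using that \<Delta> unfolding mem_K vertices_K by (cases v) blast+
  qed

  obtain P :: "(nat \<Rightarrow>\<^sub>0 real) set" and f where simplicial: "simplicial_polytope P"
    and sym: "uminus ` P = P" and f: "bij_betw f (vertices K) (vertices (boundary_complex P))"
    and f_K: "(\<lambda>\<sigma>. f ` \<sigma>) ` K = boundary_complex P"
    using polytopal unfolding cs_polytopal_def complex_iso_def K_def [symmetric]
    by (elim exE conjE) (rule that)
  have poly: "polytope P" using simplicial unfolding simplicial_polytope_def by blast
  then have "convex P" unfolding polytope_def by auto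
  define E where "E = {v. v extreme_point_of P}"
  have P_hull: "P = convex hull E"
    unfolding E_def using poly by (rule polytope_eq_convex_hull_extreme_points)
  have ext_face: "{v. v extreme_point_of F} = E \<inter> F" if "F face_of P" for F
    using extreme_point_of_face [OF that] by (auto simp: E_def)
  have face_K: "\<exists>F. F face_of P \<and> F \<noteq> P \<and> f ` S = E \<inter> F" if "S \<in> K" for S
  proof -
    have "f ` S \<in> boundary_complex P" using that f_K by blast
    then show ?thesis unfolding boundary_complex_def using ext_face by auto
  qed
  have K_face: "\<exists>S\<in>K. f ` S = E \<inter> F" if "F face_of P" "F \<noteq> P" for F
  proof -
    have "E \<inter> F \<in> boundary_complex P" unfolding boundary_complex_def using that ext_face by blast
    then show ?thesis using f_K by (metis imageE)
  qed
  \<comment> \<open>A single point has no nonempty proper face and could not carry a vertex. Hence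
    every extreme point of \<open>P\<close> is a proper face, so it is a vertex of the boundary
    complex.\<close>
  have P_sing: "P \<noteq> {v}" for v
  proof
    assume v: "P = {v}"
    obtain i where "i \<in> V" using \<open>V \<noteq> {}\<close> by blast
    then have "{Inl i} \<in> K" by (simp add: mem_K sing \<open>{} \<in> \<Delta>\<close>)
    then obtain F where F: "F face_of P" "F \<noteq> P" "f ` {Inl i} = E \<inter> F" using face_K by blast
    then have "F \<noteq> {}" by auto
    then show False using face_of_imp_subset [OF F(1)] F(2) v by auto
  qed
  have sing_face: "{v} face_of P" "{v} \<noteq> P" if "v \<in> E" for v
    using that P_sing face_of_singleton unfolding E_def by auto
  have vertices_P: "vertices (boundary_complex P) = E"
  proof
    show "vertices (boundary_complex P) \<subseteq> E"
      unfolding vertices_def boundary_complex_def using ext_face by auto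
  next
    show "E \<subseteq> vertices (boundary_complex P)"
    proof
      fix v assume "v \<in> E"
      then have "{v} = {w. w extreme_point_of {v}}" "{v} face_of P" "{v} \<noteq> P"
        using sing_face by auto
      then show "v \<in> vertices (boundary_complex P)"
        unfolding vertices_def boundary_complex_def by blast
    qed
  qed
  have inj_f: "inj_on f (vertices K)" and f_E: "f ` vertices K = E"
    using f unfolding bij_betw_def vertices_P by auto

  define p where "p i = f (Inl i)" for i
  have inj_p: "inj_on p V"
    using inj_f unfolding p_def vertices_K by (auto simp: inj_on_def)
  have p_E: "p i \<in> E" if "i \<in> V" for i using that f_E unfolding p_def vertices_K by blast
  \<comment> \<open>The point \<open>- p i\<close> is a vertex that shares no proper face with
    \<open>p i\<close>, as their midpoint is 0. But x_i forms an edge with every vertex other than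
    itself and y_i, because \<open>\<Delta>\<close> contains all pairs.\<close>
  have f_Inr: "f (Inr i) = - p i" if i: "i \<in> V" for i
  proof -
    have "- p i \<in> E" using p_E [OF i] extreme_point_of_uminus [OF _ sym] unfolding E_def by auto
    then obtain w where w: "w \<in> vertices K" "f w = - p i" using f_E by (metis imageE)
    have "w \<noteq> Inl i"
    proof
      assume "w = Inl i"
      then have "p i = - p i" using w p_def by simp
      then have "p i = 0" by (metis real_vector.scale_eq_0_iff add_eq_0_iff scaleR_2 zero_neq_numeral)
      then show False
        using zero_notin_proper_face [OF sing_face [OF p_E [OF i]] sym] by simp
    qed
    moreover have "{Inl i, w} \<notin> K"
    proof
      assume "{Inl i, w} \<in> K"
      then obtain F where F: "F face_of P" "F \<noteq> P" "f ` {Inl i, w} = E \<inter> F" using face_K by blast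
      then have "p i \<in> F" "- p i \<in> F" using w p_def by auto
      then have "(1/2) *\<^sub>R p i + (1/2) *\<^sub>R (- p i) \<in> F"
        using face_of_imp_convex [OF F(1)] by (intro convexD) auto
      then show False using zero_notin_proper_face [OF F(1,2) sym] by simp
    qed
    moreover have "{Inl i, w} \<in> K" if "w \<noteq> Inl i" "w \<noteq> Inr i"
    proof (cases w)
      case (Inl j)
      then have "j \<in> V" using w vertices_K by auto
      have "Inl -` {Inl i, Inl j :: 'a + 'a} = {i, j}" "Inr -` {Inl i, Inl j :: 'a + 'a} = {}" by auto
      then show ?thesis using i \<open>j \<in> V\<close> Inl
        unfolding mem_K by (simp add: small \<open>{} \<in> \<Delta>\<close> card_insert_if)
    next
      case (Inr j)
      then have "j \<in> V" using w vertices_K by auto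
      have "Inl -` {Inl i, Inr j} = {i}" "Inr -` {Inl i, Inr j} = {j}" by auto
      then show ?thesis using i \<open>j \<in> V\<close> Inr that
        unfolding mem_K by (simp add: sing)
    qed
    ultimately show ?thesis using w by blast
  qed
  have E_eq: "E = p ` V \<union> (uminus \<circ> p) ` V"
    unfolding f_E [symmetric] vertices_K image_Un image_image p_def [symmetric]
    using f_Inr by (auto simp: image_iff)

  have "dependent (p ` V)"
  proof (rule ccontr)
    assume "independent (p ` V)"
    \<comment> \<open>This functional is 1 at every \<open>p i\<close> and -1 at every
      \<open>- p i\<close>, so its maximal level set is a face of \<open>P\<close> whose vertices
      are exactly the places of the x_i.\<close>
    then obtain g :: "(nat \<Rightarrow>\<^sub>0 real) \<Rightarrow> real" where g: "linear g" "\<And>i. i \<in> V \<Longrightarrow> g (p i) = 1"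
      using linear_independent_extend [of "p ` V" "\<lambda>_. 1"] by auto
    have g_neg: "g (- p i) = - 1" if "i \<in> V" for i using g that by (simp add: linear_neg)
    have "E \<subseteq> {x. g x \<le> 1}" using g(2) g_neg unfolding E_eq by auto
    moreover have "convex {x. g x \<le> 1}"
      using convex_linear_vimage [OF g(1), of "{..1}"] by (simp add: vimage_def)
    ultimately have "P \<subseteq> {x. g x \<le> 1}" unfolding P_hull by (rule hull_minimal)
    then have face: "{x \<in> P. g x = 1} face_of P"
      using face_of_level_set [OF g(1) \<open>convex P\<close>] by blast
    obtain i where i: "i \<in> V" using \<open>V \<noteq> {}\<close> by blast
    have "- p i \<in> P" using E_eq i P_hull hull_subset by fastforce
    then have "{x \<in> P. g x = 1} \<noteq> P" using g_neg [OF i] by force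
    then obtain S where S: "S \<in> K" "f ` S = E \<inter> {x \<in> P. g x = 1}" using K_face face by blast
    moreover have "E \<inter> {x \<in> P. g x = 1} = p ` V"
      using g(2) g_neg hull_subset [of E convex] unfolding P_hull [symmetric] by (auto simp: E_eq)
    ultimately have "f ` S = f ` (Inl ` V)" unfolding p_def by (simp add: image_image)
    then have "S = Inl ` V"
      using inj_on_image_eq_iff [OF inj_f K_vertices [OF S(1)]] vertices_K by auto
    then have "Inl -` S = V" by auto
    then show False using S(1) \<open>V \<notin> \<Delta>\<close> unfolding mem_K by simp
  qed
  then obtain u where u: "\<exists>v\<in>p ` V. u v \<noteq> 0" "(\<Sum>v\<in>p ` V. u v *\<^sub>R v) = 0"
    unfolding dependent_finite [OF finite_imageI [OF V]] by (elim exE conjE) (rule that)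
  define a where "a = u \<circ> p"
  have a: "\<exists>i\<in>V. a i \<noteq> 0" "(\<Sum>i\<in>V. a i *\<^sub>R p i) = 0"
    using u inj_p by (auto simp: a_def sum.reindex)

  show thesis
  proof (rule that)
    fix \<sigma> j
    assume \<sigma>: "\<sigma> \<in> \<Delta>" and j: "j \<in> V - \<sigma>" and \<tau>: "V - \<sigma> - {j} \<in> \<Delta>"
    define I where "I = V - {j}"
    \<comment> \<open>\<open>s\<close> lists the vertices of the face: x_i on
      \<open>\<sigma>\<close> and y_i elsewhere. The signs in \<open>b\<close> cancel those of the
      places \<open>- p i\<close> of the y_i, so that
      \<open>b i *\<^sub>R f (s i) = a i *\<^sub>R p i\<close>.\<close>
    define s :: "'a \<Rightarrow> 'a + 'a" where "s i = (if i \<in> \<sigma> then Inl i else Inr i)" for i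
    define b where "b i = (if i \<in> \<sigma> then a i else - a i)" for i
    have \<sigma>V: "\<sigma> \<subseteq> V" using \<sigma> \<Delta> by blast
    have I_split: "I = \<sigma> \<union> (V - \<sigma> - {j})" using \<sigma>V j unfolding I_def by auto
    have "Inl -` (s ` I) = \<sigma>" "Inr -` (s ` I) = V - \<sigma> - {j}"
      using \<sigma>V j unfolding I_def s_def by (auto split: if_splits)
    then have sK: "s ` I \<in> K" unfolding mem_K using \<sigma> \<tau> by auto
    then obtain F where F: "F face_of P" "F \<noteq> P" "f ` (s ` I) = E \<inter> F" using face_K by blast
    \<comment> \<open>Simpliciality enters here: the vertices of \<open>F\<close> lie in an affinely
      independent set.\<close>
    obtain C where C: "finite C" "\<not> affine_dependent C" "F = convex hull C"
      using simplicial F unfolding simplicial_polytope_def by blast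
    have "{v. v extreme_point_of F} \<subseteq> C"
      unfolding C(3) by (rule extreme_points_of_convex_hull)
    then have "E \<inter> F \<subseteq> C" using ext_face [OF F(1)] by simp
    then have indep: "\<not> affine_dependent ((f \<circ> s) ` I)"
      using C(2) F(3) affine_dependent_subset by (metis image_comp)
    have inj: "inj_on (f \<circ> s) I"
    proof (rule comp_inj_on)
      show "inj_on s I" by (auto simp: inj_on_def s_def split: if_splits)
      show "inj_on f (s ` I)" using inj_f K_vertices [OF sK] by (rule inj_on_subset)
    qed
    have notin: "f v \<notin> F" if "v \<in> {Inl j, Inr j}" for v
    proof
      assume "f v \<in> F"
      have v: "v \<in> vertices K" using that j unfolding vertices_K by auto
      then have "f v \<in> f ` (s ` I)" using \<open>f v \<in> F\<close> F(3) f_E by blast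
      then have "v \<in> s ` I" using inj_on_image_mem_iff [OF inj_f v K_vertices [OF sK]] by simp
      then show False using that by (auto simp: s_def I_def split: if_splits)
    qed
    have "\<bar>sum b I\<bar> < \<bar>a j\<bar>"
    proof (rule proper_face_relation [OF F(1,2) \<open>convex P\<close> sym, where u = "p j" and w = "f \<circ> s"])
      show "p j \<in> P" using p_E j P_hull hull_subset by fastforce
      show "p j \<notin> F" "- p j \<notin> F" using notin [of "Inl j"] notin [of "Inr j"] f_Inr [of j] j unfolding p_def by auto
      show "finite I" using V I_def by simp
      show "(f \<circ> s) i \<in> F" if "i \<in> I" for i using F(3) that by auto
      have "b i *\<^sub>R (f \<circ> s) i = a i *\<^sub>R p i" if "i \<in> I" for i
        using f_Inr [of i] that unfolding b_def s_def I_def p_def by auto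
      then have "(\<Sum>i\<in>I. b i *\<^sub>R (f \<circ> s) i) = (\<Sum>i\<in>I. a i *\<^sub>R p i)" by simp
      then show "(\<Sum>i\<in>I. b i *\<^sub>R (f \<circ> s) i) + a j *\<^sub>R p j = 0"
        using a(2) sum.remove [of V j "\<lambda>i. a i *\<^sub>R p i"] V j unfolding I_def by (simp add: add.commute)
      show "a j \<noteq> 0 \<or> (\<exists>i\<in>I. b i \<noteq> 0)" using a(1) unfolding I_def b_def by auto
    qed (fact inj indep)+
    moreover have "sum b I = sum a \<sigma> - sum a (V - \<sigma> - {j})"
    proof -
      have "sum b I = sum b \<sigma> + sum b (V - \<sigma> - {j})"
        unfolding I_split using V \<sigma>V by (intro sum.union_disjoint) (auto intro: finite_subset)
      then show ?thesis unfolding b_def by (simp add: sum_negf)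
    qed
    ultimately show "\<bar>sum a \<sigma> - sum a (V - \<sigma> - {j})\<bar> < \<bar>a j\<bar>" by simp
  qed
qed

section \<open>Self-dual complexes and neighborliness\<close>

text \<open>Complementation exchanges the sizes below and above \<open>h\<close>, and
  \<open>H\<close> contains exactly one set of each complementary pair of size \<open>h\<close>. So
  the complements of the nonfaces are exactly the faces.\<close>

lemma bier_half_complex:
  fixes V :: "'a set" and h :: nat and H :: "'a set set"
  defines "\<Delta> \<equiv> {\<sigma>. \<sigma> \<subseteq> V \<and> (card \<sigma> < h \<or> card \<sigma> = h \<and> \<sigma> \<in> H)}"
  assumes V: "finite V" "card V = 2 * h"
    and H: "\<And>\<sigma>. \<sigma> \<subseteq> V \<Longrightarrow> card \<sigma> = h \<Longrightarrow> \<sigma> \<in> H \<longleftrightarrow> V - \<sigma> \<notin> H"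
  shows abs_complex_on_half_complex: "abs_complex_on V \<Delta>"
    and alexander_dual_half_complex: "alexander_dual V \<Delta> = \<Delta>"
proof -
  have "\<tau> \<in> \<Delta>" if "\<sigma> \<in> \<Delta>" "\<tau> \<subseteq> \<sigma>" for \<sigma> \<tau>
  proof (cases "\<tau> = \<sigma>")
    case False
    then have "card \<tau> < card \<sigma>"
      using that V by (intro psubset_card_mono) (auto simp: \<Delta>_def intro: finite_subset)
    then show ?thesis using that by (auto simp: \<Delta>_def)
  qed (use that in simp)
  moreover have "\<Delta> \<subseteq> Pow V" by (auto simp: \<Delta>_def)
  ultimately show "abs_complex_on V \<Delta>" using V(1) unfolding abs_complex_on_def by blast
next
  have compl: "V - \<sigma> \<in> \<Delta> \<longleftrightarrow> \<sigma> \<notin> \<Delta>" if "\<sigma> \<subseteq> V" for \<sigma>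
  proof -
    have "card \<sigma> \<le> 2 * h" using card_mono [OF V(1) that] V by simp
    moreover have "card (V - \<sigma>) = 2 * h - card \<sigma>"
      using that V by (simp add: card_Diff_subset finite_subset)
    ultimately show ?thesis using that H [OF that] by (auto simp: \<Delta>_def)
  qed
  have "\<sigma> \<in> alexander_dual V \<Delta> \<longleftrightarrow> \<sigma> \<in> \<Delta>" if "\<sigma> \<subseteq> V" for \<sigma>
  proof -
    have "\<sigma> \<in> alexander_dual V \<Delta> \<longleftrightarrow> V - \<sigma> \<notin> \<Delta>"
      unfolding alexander_dual_def using that by (auto simp: double_diff)
    then show ?thesis using compl [OF that] by blast
  qed
  then show "alexander_dual V \<Delta> = \<Delta>"
    by (auto simp: alexander_dual_def \<Delta>_def)
qed

text \<open>The involution swaps x_i with y_i and preserves faces by self-duality. An invariant face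
  would have equal and disjoint index sets, hence be empty. A set without antipodal pairs splits
  into two disjoint index sets of size at most \<open>k\<close>, both in
  \<open>\<Delta>\<close>.\<close>

lemma cs_neighborly_bier:
  fixes V :: "'a set"
  assumes dual: "alexander_dual V \<Delta> = \<Delta>"
    and small: "\<And>\<sigma>. \<sigma> \<subseteq> V \<Longrightarrow> card \<sigma> \<le> k \<Longrightarrow> \<sigma> \<in> \<Delta>"
  shows "cs_neighborly k (bier V \<Delta>)"
proof -
  define \<iota> :: "'a + 'a \<Rightarrow> 'a + 'a" where "\<iota> = case_sum Inr Inl"
  have mem: "S \<in> bier V \<Delta> \<longleftrightarrow> Inl -` S \<in> \<Delta> \<and> Inr -` S \<in> \<Delta> \<and> Inl -` S \<inter> Inr -` S = {}" for S
    by (simp add: mem_bier_iff dual)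
  have \<Delta>: "\<Delta> \<subseteq> Pow V" using alexander_dual_subset [of V \<Delta>] dual by simp
  have \<iota>\<iota>: "\<iota> (\<iota> v) = v" for v by (cases v) (auto simp: \<iota>_def)
  have vimage: "Inl -` (\<iota> ` S) = Inr -` S" "Inr -` (\<iota> ` S) = Inl -` S" for S
    by (force simp: \<iota>_def image_iff split: sum.splits)+
  have face: "\<iota> ` S \<in> bier V \<Delta>" if "S \<in> bier V \<Delta>" for S
    using that unfolding mem vimage by blast
  have "cs_involution \<iota> (bier V \<Delta>)"
    unfolding cs_involution_def
  proof (intro conjI ballI impI)
    fix v assume "v \<in> vertices (bier V \<Delta>)"
    then show "\<iota> v \<in> vertices (bier V \<Delta>)" using face [of "{v}"] by (simp add: vertices_def)
  next
    fix S assume S: "S \<in> bier V \<Delta>" "S \<noteq> {}"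
    show "\<iota> ` S \<noteq> S"
    proof
      assume "\<iota> ` S = S"
      then have "Inl -` S = {}" "Inr -` S = {}" using vimage [of S] S(1) mem by auto
      then show False using S(2) by (metis all_not_in_conv sumE vimageI)
    qed
  qed (use face \<iota>\<iota> in auto)
  moreover have "S \<in> bier V \<Delta>"
    if "S \<subseteq> vertices (bier V \<Delta>)" "finite S" "card S = k" "\<forall>v\<in>S. \<iota> v \<notin> S" for S
  proof -
    have "Inl -` S \<subseteq> V" "Inr -` S \<subseteq> V"
      using that(1) \<Delta> unfolding vertices_def mem by fastforce+
    moreover have "card (Inl -` S) \<le> k" "card (Inr -` S) \<le> k"
      using that(2,3) by (auto intro!: card_inj_on_le simp flip: that(3))
    moreover have "Inl -` S \<inter> Inr -` S = {}" using that(4) by (auto simp: \<iota>_def)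
    ultimately show ?thesis unfolding mem using small by blast
  qed
  ultimately show ?thesis unfolding cs_neighborly_def by blast
qed

lemma card_vertices_bier:
  fixes V :: "'a set"
  assumes V: "finite V" and dual: "alexander_dual V \<Delta> = \<Delta>"
    and small: "\<And>\<sigma>. \<sigma> \<subseteq> V \<Longrightarrow> card \<sigma> \<le> 1 \<Longrightarrow> \<sigma> \<in> \<Delta>"
  shows "card (vertices (bier V \<Delta>)) = 2 * card V"
proof -
  have "card (Inl ` V \<union> Inr ` V :: ('a + 'a) set) = card (Inl ` V :: ('a + 'a) set) + card (Inr ` V :: ('a + 'a) set)"
    using V by (intro card_Un_disjoint) auto
  then show ?thesis by (simp add: vertices_bier [OF dual small] card_image)
qed

section \<open>A self-dual complex that is not threshold\<close>

text \<open>Number the edges of the complete graph on four vertices from 1 to 6: the four triples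
  are the edge sets at its vertices, so each number occurs twice. The blocks \<open>M\<close> and
  \<open>N\<close>, both empty for \<open>h = 3\<close>, partition the remaining elements, pad the
  triples to size \<open>h\<close> and are used twice each.\<close>

lemma half_complex_not_cs_polytopal:
  fixes h :: nat and H :: "nat set set"
  assumes "3 \<le> h"
  defines "V \<equiv> {1..2 * h}" and "M \<equiv> {7..h + 3}" and "N \<equiv> {h + 4..2 * h}"
  defines "\<Delta> \<equiv> {\<sigma>. \<sigma> \<subseteq> V \<and> (card \<sigma> < h \<or> card \<sigma> = h \<and> \<sigma> \<in> H)}"
  assumes H: "\<And>\<sigma>. \<sigma> \<subseteq> V \<Longrightarrow> card \<sigma> = h \<Longrightarrow> \<sigma> \<in> H \<longleftrightarrow> V - \<sigma> \<notin> H"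
    and Q: "{{1,2,3} \<union> M, {1,4,5} \<union> M, {2,4,6} \<union> N, {3,5,6} \<union> N} \<subseteq> H"
  shows "\<not> cs_polytopal (bier V \<Delta>)"
proof
  assume "cs_polytopal (bier V \<Delta>)"
  moreover have dual: "alexander_dual V \<Delta> = \<Delta>"
    unfolding \<Delta>_def using H by (intro alexander_dual_half_complex) (auto simp: V_def)
  moreover have "\<sigma> \<in> \<Delta>" if "\<sigma> \<subseteq> V" "card \<sigma> \<le> 2" for \<sigma> using that assms(1) by (auto simp: \<Delta>_def)
  ultimately obtain a :: "nat \<Rightarrow> real"
    where a: "\<And>\<sigma> j. \<lbrakk>\<sigma> \<in> \<Delta>; j \<in> V - \<sigma>; V - \<sigma> - {j} \<in> \<Delta>\<rbrakk> \<Longrightarrow>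
           \<bar>sum a \<sigma> - sum a (V - \<sigma> - {j})\<bar> < \<bar>a j\<bar>"
    using cs_polytopal_bier_weights [of V \<Delta>] by (auto simp: V_def)
  \<comment> \<open>Here \<open>X\<close> and \<open>V - X - {j}\<close>, of sizes \<open>h\<close>
    and \<open>h - 1\<close>, are both in \<open>\<Delta>\<close>. Expressing the weight of the
    latter through \<open>sum a V\<close> leaves an inequality in \<open>X\<close> and
    \<open>j\<close> alone.\<close>
  have weight: "\<bar>2 * sum a X - sum a V + a j\<bar> < \<bar>a j\<bar>"
    if "X \<in> H" "X \<subseteq> V" "card X = h" "j \<in> V - X" for X j
  proof -
    have fin: "finite V" "finite X" using that finite_subset by (auto simp: V_def)
    have "card (V - X) = h" using that fin by (simp add: card_Diff_subset V_def)
    then have "card (V - X - {j}) < h" using that fin assms(1) by simp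
    then have "\<bar>sum a X - sum a (V - X - {j})\<bar> < \<bar>a j\<bar>"
      using that by (intro a) (auto simp: \<Delta>_def)
    moreover have "sum a (V - X - {j}) = sum a V - sum a X - a j"
      using that fin by (simp add: sum_diff1 sum_diff)
    ultimately show ?thesis by (simp add: algebra_simps)
  qed
  have MN: "finite M" "finite N" "M \<inter> N = {}" "M \<inter> {1..6} = {}" "N \<inter> {1..6} = {}"
    "card M = h - 3" "card N = h - 3" "M \<subseteq> V" "N \<subseteq> V"
    using assms(1) by (auto simp: M_def N_def V_def)
  have V_eq: "V = {1,2,3,4,5,6} \<union> M \<union> N"
    using assms(1) by (auto simp: V_def M_def N_def)
  have six: "{1..6::nat} = {1,2,3,4,5,6}" by auto
  have block: "sum a ({i, j, k} \<union> L) = a i + a j + a k + sum a L" "card ({i, j, k} \<union> L) = h"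
    "{i, j, k} \<union> L \<subseteq> V"
    if "L = M \<or> L = N" "distinct [i, j, k]" "{i, j, k} \<subseteq> {1..6}" for i j k L
  proof -
    have L: "finite L" "card L = h - 3" "{i, j, k} \<inter> L = {}" "L \<subseteq> V" using that MN by blast+
    show "sum a ({i, j, k} \<union> L) = a i + a j + a k + sum a L"
      using that(2) L by (subst sum.union_disjoint) auto
    show "card ({i, j, k} \<union> L) = h"
      using that(2) L assms(1) by (subst card_Un_disjoint) auto
    show "{i, j, k} \<union> L \<subseteq> V" using that(3) L(4) unfolding V_eq six by blast
  qed
  have "sum a V = a 1 + a 2 + a 3 + a 4 + a 5 + a 6 + sum a M + sum a N"
  proof -
    have "sum a V = sum a {1..6} + sum a M + sum a N"
      unfolding V_eq six [symmetric] using MN by (subst sum.union_disjoint; auto)+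
    moreover have "sum a {1..6} = a 1 + a 2 + a 3 + a 4 + a 5 + a 6" unfolding six by simp
    ultimately show ?thesis by simp
  qed
  have ne: "i \<notin> M" "i \<notin> N" "i \<in> V" if "i \<in> {1,2,3,4,5,6}" for i
    using that MN(4,5) unfolding V_eq six by blast+
  \<comment> \<open>\<open>weight\<close> forces \<open>2 * sum a X - sum a V\<close> and \<open>a j\<close> to have strictly opposite signs. The complement
    of the first set meets the other three complements in 6, 5 and 4, so the four differences have the
    same sign, although they add up to 0.\<close>
  have 1: "\<bar>2 * (a 1 + a 2 + a 3 + sum a M) - sum a V + a j\<bar> < \<bar>a j\<bar>" if "j \<in> {4,5,6}" for j
    using weight [of "{1,2,3} \<union> M" j] block [of M 1 2 3] Q ne [of j] that by auto
  have 2: "\<bar>2 * (a 1 + a 4 + a 5 + sum a M) - sum a V + a 6\<bar> < \<bar>a 6\<bar>"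
    using weight [of "{1,4,5} \<union> M" 6] block [of M 1 4 5] Q ne [of 6] by auto
  have 3: "\<bar>2 * (a 2 + a 4 + a 6 + sum a N) - sum a V + a 5\<bar> < \<bar>a 5\<bar>"
    using weight [of "{2,4,6} \<union> N" 5] block [of N 2 4 6] Q ne [of 5] by auto
  have 4: "\<bar>2 * (a 3 + a 5 + a 6 + sum a N) - sum a V + a 4\<bar> < \<bar>a 4\<bar>"
    using weight [of "{3,5,6} \<union> N" 4] block [of N 3 5 6] Q ne [of 4] by auto
  show False
    using 1 [of 4] 1 [of 5] 1 [of 6] 2 3 4 \<open>sum a V = _\<close> by (smt (verit) insertCI)
qed

theorem theorem1p1:
  fixes d k :: nat
  assumes "even d" and "6 \<le> d" and "2 \<le> k" and "k \<le> (d - 2) div 2"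
  shows "\<exists>K. bier_sphere (d - 2) K \<and> card (vertices K) = 2 * d \<and>
             cs_neighborly k K \<and> \<not> cs_polytopal K"
proof -
  obtain h where d: "d = 2 * h" using assms(1) by blast
  \<comment> \<open>The upper bound on \<open>k\<close> is \<open>h - 1\<close>, so every set of at
    most \<open>k\<close> elements lies below the middle layer and is a face.\<close>
  have h: "3 \<le> h" "k < h" using assms d by auto
  define V where "V = {1..2 * h}"
  define M where "M = {7..h + 3}"
  define N where "N = {h + 4..2 * h}"
  define Q where "Q = {{1,2,3} \<union> M, {1,4,5} \<union> M, {2,4,6} \<union> N, {3,5,6} \<union> N}"
  \<comment> \<open>A complementary pair that meets \<open>Q\<close> is decided in favour of its
    member in \<open>Q\<close>, any other pair in favour of the set containing 1. This is consistent
    because any two sets of \<open>Q\<close> intersect and so are never complementary.\<close>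
  define H where "H = {\<sigma>. \<sigma> \<in> Q \<or> V - \<sigma> \<notin> Q \<and> 1 \<in> \<sigma>}"
  define \<Delta> where "\<Delta> = {\<sigma>. \<sigma> \<subseteq> V \<and> (card \<sigma> < h \<or> card \<sigma> = h \<and> \<sigma> \<in> H)}"
  have V: "finite V" "card V = 2 * h" "1 \<in> V" using h by (auto simp: V_def)
  have "X \<inter> Y \<noteq> {}" if "X \<in> Q" "Y \<in> Q" for X Y
    using that unfolding Q_def by (elim insertE emptyE; hypsubst; simp)
  then have "V - \<sigma> \<notin> Q" if "\<sigma> \<in> Q" for \<sigma> using that by blast
  then have H: "\<sigma> \<in> H \<longleftrightarrow> V - \<sigma> \<notin> H" if "\<sigma> \<subseteq> V" for \<sigma>
    using V(3) double_diff [OF that order_refl] unfolding H_def by auto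
  have complex: "abs_complex_on V \<Delta>" and dual: "alexander_dual V \<Delta> = \<Delta>"
    unfolding \<Delta>_def
    by (rule abs_complex_on_half_complex [OF V(1,2) H] alexander_dual_half_complex [OF V(1,2) H];
        assumption)+
  have small: "\<sigma> \<in> \<Delta>" if "\<sigma> \<subseteq> V" "card \<sigma> < h" for \<sigma> using that by (simp add: \<Delta>_def)
  have "V \<notin> \<Delta>" using V h by (simp add: \<Delta>_def)
  moreover have "{} \<in> \<Delta>" using small h by simp
  ultimately have "\<Delta> \<noteq> {}" "\<Delta> \<noteq> Pow V" by auto
  moreover have "V = {1..(d - 2) + 2}" using d h by (simp add: V_def)
  ultimately have "bier_sphere (d - 2) (bier V \<Delta>)"
    using complex unfolding bier_sphere_def by metis
  moreover have "card (vertices (bier V \<Delta>)) = 2 * d"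
    using card_vertices_bier [OF V(1) dual small] h V d by simp
  moreover have "cs_neighborly k (bier V \<Delta>)"
    using cs_neighborly_bier [OF dual small] h by simp
  moreover have "\<not> cs_polytopal (bier V \<Delta>)"
    using half_complex_not_cs_polytopal [of h H] h H
    by (auto simp: \<Delta>_def V_def H_def Q_def M_def N_def)
  ultimately show ?thesis by blast
qed

end
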